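(* For positive integers $h$, $w$, and $n$, $$ \det_{1\le i,j\le h}\left(F_{-i+j,2h+2w+2}(x_1,\dots,x_n)-F_{i+j,2h+2w+2}(x_1,\dots,x_n)\right)=\sum_{T\in\mathrm{UD}_n(h,w)}\omega(T). $$
   Context: $e_k(x_1,\dots,x_n)$ is the $k$-th elementary symmetric polynomial ($e_0=1$; $e_k=0$ for $k<0$ or $k>n$). $f_r=\sum_{i\in\mathbb Z}e_ie_{i+r}$ and $F_{r,N}=\sum_{k\in\mathbb Z}f_{r+Nk}$, all evaluated at $x_1,\dots,x_n$. $\mathrm{UD}_n(h,w)$ is the set of $(h,w)$-up-down tableaux, i.e. sequences $(\lambda^0,\lambda^1,\dots,\lambda^{2n})$ of partitions such that: (i) $\emptyset=\lambda^0\subseteq\lambda^1\supseteq\lambda^2\subseteq\lambda^3\supseteq\lambda^4\subseteq\dots\subseteq\lambda^{2n-1}\supseteq\lambda^{2n}=\emptyset$ (containment of Young diagrams); (ii) each pair $(\lambda^{i-1},\lambda^i)$ differs by a vertical strip, that is, by a collection of cells containing at most one cell in each row, $i=1,\dots,2n$; (iii) each $\lambda^i$ has at most $h$ rows, $i=1,\dots,2n$; (iv) each $\lambda^{2i}$ has at most $w$ columns, $i=1,\dots,n$. The weight of $T=(\lambda^0,\dots,\lambda^{2n})$ is $\omega(T)=\prod_{i=1}^n x_i^{-|\lambda^{2i-2}|+2|\lambda^{2i-1}|-|\lambda^{2i}|}$, where $|\lambda|$ is the size (sum of parts) of $\lambda$. *)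

theory Defs
  imports
    "HOL-Library.Groups_Big_Fun"
    "Jordan_Normal_Form.Determinant"
begin

section \<open>Elementary symmetric polynomials and the sums over the integers\<close>

text \<open>Everything is evaluated at elements \<open>x 1, \<dots>, x n\<close> of an arbitrary commutative ring; taking a
  polynomial ring gives the identity between formal polynomials. For \<open>k < 0\<close> and \<open>k > n\<close> the outer
  sum is empty.\<close>

definition esym :: "nat \<Rightarrow> (nat \<Rightarrow> 'a) \<Rightarrow> int \<Rightarrow> 'a::comm_ring_1" where
  "esym n x k = (\<Sum>S | S \<subseteq> {1..n} \<and> int (card S) = k. \<Prod>i\<in>S. x i)"

text \<open>\<open>Sum_any\<close> sums over the whole index type, here \<open>int\<close>, and is \<open>0\<close> if the support is infinite.
  The supports below are finite, see \<open>finite_support_fsum\<close> and \<open>finite_support_Fsum\<close>.\<close>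

definition fsum :: "nat \<Rightarrow> (nat \<Rightarrow> 'a) \<Rightarrow> int \<Rightarrow> 'a::comm_ring_1" where
  "fsum n x r = Sum_any (\<lambda>i::int. esym n x i * esym n x (i + r))"

definition Fsum :: "nat \<Rightarrow> (nat \<Rightarrow> 'a) \<Rightarrow> int \<Rightarrow> int \<Rightarrow> 'a::comm_ring_1" where
  "Fsum n x r N = Sum_any (\<lambda>k::int. fsum n x (r + N * k))"

lemma esym_eq_0: "k < 0 \<or> int n < k \<Longrightarrow> esym n x k = 0"
proof -
  assume k: "k < 0 \<or> int n < k"
  have "card S \<le> n" if "S \<subseteq> {1..n}" for S
    using card_mono[OF _ that] by simp
  then have "int (card S) \<noteq> k" if "S \<subseteq> {1..n}" for S
  proof -
    have "int (card S) \<le> int n" using \<open>\<And>S. S \<subseteq> {1..n} \<Longrightarrow> card S \<le> n\<close>[OF that] by simp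
    then show ?thesis using k by linarith
  qed
  then have "{S. S \<subseteq> {1..n} \<and> int (card S) = k} = {}" by blast
  then show ?thesis by (simp only: esym_def sum.empty)
qed

lemma finite_support_fsum: "finite {i. esym n x i * esym n x (i + r) \<noteq> 0}"
proof (rule finite_subset)
  show "{i. esym n x i * esym n x (i + r) \<noteq> 0} \<subseteq> {0..int n}"
  proof
    fix i assume "i \<in> {i. esym n x i * esym n x (i + r) \<noteq> 0}"
    then have "esym n x i \<noteq> 0" by auto
    then have "\<not> (i < 0 \<or> int n < i)" by (rule contrapos_nn) (rule esym_eq_0)
    then show "i \<in> {0..int n}" by simp
  qed
qed simp

lemma fsum_eq_0: "int n < \<bar>r\<bar> \<Longrightarrow> fsum n x r = 0"
proof -
  assume r: "int n < \<bar>r\<bar>"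
  have "esym n x i * esym n x (i + r) = 0" for i
  proof (cases "i < 0 \<or> int n < i")
    case False
    then have "i + r < 0 \<or> int n < i + r" using r by linarith
    then show ?thesis by (simp add: esym_eq_0)
  qed (simp add: esym_eq_0)
  then show ?thesis by (simp add: fsum_def)
qed

lemma finite_support_Fsum:
  assumes "N \<noteq> 0"
  shows "finite {k. fsum n x (r + N * k) \<noteq> 0}"
proof (rule finite_subset)
  show "{k. fsum n x (r + N * k) \<noteq> 0} \<subseteq> {- (int n + \<bar>r\<bar>)..int n + \<bar>r\<bar>}"
  proof
    fix k assume "k \<in> {k. fsum n x (r + N * k) \<noteq> 0}"
    then have "\<not> int n < \<bar>r + N * k\<bar>" using fsum_eq_0[of n "r + N * k" x] by auto
    then have "\<bar>N * k\<bar> \<le> int n + \<bar>r\<bar>" by linarith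
    moreover have "\<bar>k\<bar> \<le> \<bar>N * k\<bar>"
      using assms mult_right_mono[of 1 "\<bar>N\<bar>" "\<bar>k\<bar>"] by (simp add: abs_mult)
    ultimately show "k \<in> {- (int n + \<bar>r\<bar>)..int n + \<bar>r\<bar>}" by auto
  qed
qed simp

section \<open>Partitions\<close>

text \<open>A partition is a weakly decreasing, eventually zero function; row \<open>i\<close> (counted from \<open>0\<close>) of its
  Young diagram has \<open>lam i\<close> cells.\<close>

definition is_partition :: "(nat \<Rightarrow> nat) \<Rightarrow> bool" where
  "is_partition lam \<longleftrightarrow> antimono lam \<and> finite {i. lam i \<noteq> 0}"

definition diagram :: "(nat \<Rightarrow> nat) \<Rightarrow> (nat \<times> nat) set" where
  "diagram lam = {(i, j). j < lam i}"

definition psize :: "(nat \<Rightarrow> nat) \<Rightarrow> nat" where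
  "psize lam = (\<Sum>i | lam i \<noteq> 0. lam i)"

definition num_rows :: "(nat \<Rightarrow> nat) \<Rightarrow> nat" where
  "num_rows lam = card (fst ` diagram lam)"

definition num_columns :: "(nat \<Rightarrow> nat) \<Rightarrow> nat" where
  "num_columns lam = card (snd ` diagram lam)"

definition vertical_strip :: "(nat \<times> nat) set \<Rightarrow> bool" where
  "vertical_strip D \<longleftrightarrow> (\<forall>i j j'. (i, j) \<in> D \<longrightarrow> (i, j') \<in> D \<longrightarrow> j = j')"

definition differ_by_vertical_strip :: "(nat \<Rightarrow> nat) \<Rightarrow> (nat \<Rightarrow> nat) \<Rightarrow> bool" where
  "differ_by_vertical_strip lam mu \<longleftrightarrow>
     vertical_strip ((diagram lam - diagram mu) \<union> (diagram mu - diagram lam))"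

section \<open>Up-down tableaux\<close>

definition UD :: "nat \<Rightarrow> nat \<Rightarrow> nat \<Rightarrow> (nat \<Rightarrow> nat) list set" where
  "UD n h w = {T. length T = 2 * n + 1 \<and> (\<forall>lam\<in>set T. is_partition lam) \<and>
     diagram (T ! 0) = {} \<and> diagram (T ! (2 * n)) = {} \<and>
     (\<forall>i\<in>{1..n}. diagram (T ! (2 * i - 2)) \<subseteq> diagram (T ! (2 * i - 1)) \<and>
                 diagram (T ! (2 * i)) \<subseteq> diagram (T ! (2 * i - 1))) \<and>
     (\<forall>i\<in>{1..2 * n}. differ_by_vertical_strip (T ! (i - 1)) (T ! i)) \<and>
     (\<forall>i\<in>{1..2 * n}. num_rows (T ! i) \<le> h) \<and>
     (\<forall>i\<in>{1..n}. num_columns (T ! (2 * i)) \<le> w)}"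

text \<open>The exponent is the integer \<open>- |T\<^sub>2\<^sub>i\<^sub>-\<^sub>2| + 2 |T\<^sub>2\<^sub>i\<^sub>-\<^sub>1| - |T\<^sub>2\<^sub>i|\<close>, which is nonnegative on \<open>UD n h w\<close>
  (\<open>UD_exponent_nonneg\<close>), so that \<open>nat\<close> does not truncate.\<close>

definition weight :: "nat \<Rightarrow> (nat \<Rightarrow> 'a) \<Rightarrow> (nat \<Rightarrow> nat) list \<Rightarrow> 'a::comm_ring_1" where
  "weight n x T = (\<Prod>i = 1..n. x i ^
     nat (- int (psize (T ! (2 * i - 2))) + 2 * int (psize (T ! (2 * i - 1)))
          - int (psize (T ! (2 * i)))))"

lemma diagram_subset_iff: "diagram lam \<subseteq> diagram mu \<longleftrightarrow> (\<forall>i. lam i \<le> mu i)"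
proof
  assume sub: "diagram lam \<subseteq> diagram mu"
  show "\<forall>i. lam i \<le> mu i"
  proof (rule allI, rule ccontr)
    fix i assume "\<not> lam i \<le> mu i"
    then have "(i, mu i) \<in> diagram lam" by (simp add: diagram_def)
    with sub have "(i, mu i) \<in> diagram mu" by (rule subsetD)
    then show False by (simp add: diagram_def)
  qed
next
  assume "\<forall>i. lam i \<le> mu i"
  then show "diagram lam \<subseteq> diagram mu"
    unfolding diagram_def using less_le_trans by blast
qed

lemma psize_mono:
  assumes "diagram lam \<subseteq> diagram mu" "is_partition mu"
  shows "psize lam \<le> psize mu"
proof -
  have le: "lam i \<le> mu i" for i using assms by (simp add: diagram_subset_iff)
  have fin: "finite {i. mu i \<noteq> 0}" using assms by (simp add: is_partition_def)
  have sub: "{i. lam i \<noteq> 0} \<subseteq> {i. mu i \<noteq> 0}"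
  proof
    fix i assume "i \<in> {i. lam i \<noteq> 0}"
    then show "i \<in> {i. mu i \<noteq> 0}" using le[of i] by simp
  qed
  have "psize lam \<le> (\<Sum>i | lam i \<noteq> 0. mu i)" unfolding psize_def by (intro sum_mono le)
  also have "\<dots> \<le> psize mu" unfolding psize_def by (rule sum_mono2[OF fin sub]) simp
  finally show ?thesis .
qed

lemma UD_exponent_nonneg:
  assumes "T \<in> UD n h w" "i \<in> {1..n}"
  shows "- int (psize (T ! (2 * i - 2))) + 2 * int (psize (T ! (2 * i - 1)))
          - int (psize (T ! (2 * i))) \<ge> 0"
proof -
  have "2 * i - 1 < length T" using assms by (auto simp: UD_def)
  then have "is_partition (T ! (2 * i - 1))" using assms nth_mem unfolding UD_def by blast
  then have "psize (T ! (2 * i - 2)) \<le> psize (T ! (2 * i - 1))"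
    "psize (T ! (2 * i)) \<le> psize (T ! (2 * i - 1))"
    using assms by (auto simp: UD_def intro!: psize_mono)
  then show ?thesis by linarith
qed

lemma finite_diagram: "is_partition lam \<Longrightarrow> finite (diagram lam)"
proof -
  assume "is_partition lam"
  then have "finite (SIGMA i:{i. lam i \<noteq> 0}. {..<lam i})" by (simp add: is_partition_def)
  moreover have "diagram lam \<subseteq> (SIGMA i:{i. lam i \<noteq> 0}. {..<lam i})"
    by (auto simp: diagram_def)
  ultimately show ?thesis by (rule finite_subset[rotated])
qed

lemma rows_le_D:
  assumes "is_partition lam" "num_rows lam \<le> h" "h \<le> i"
  shows "lam i = 0"
proof (rule ccontr)
  assume "lam i \<noteq> 0"
  have "k \<in> fst ` diagram lam" if "k \<le> i" for k
  proof -
    have "lam i \<le> lam k" using that assms(1) by (simp add: is_partition_def antimonoD)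
    with \<open>lam i \<noteq> 0\<close> have "(k, 0) \<in> diagram lam" by (simp add: diagram_def)
    then show ?thesis by force
  qed
  then have "{..i} \<subseteq> fst ` diagram lam" by auto
  then have "card {..i} \<le> num_rows lam"
    unfolding num_rows_def by (intro card_mono finite_imageI finite_diagram assms)
  then show False using assms by simp
qed

lemma le_columns:
  assumes "is_partition lam"
  shows "lam i \<le> num_columns lam"
proof -
  have "{..<lam i} \<subseteq> snd ` diagram lam" by (force simp: diagram_def)
  then have "card {..<lam i} \<le> num_columns lam"
    unfolding num_columns_def by (intro card_mono finite_imageI finite_diagram assms)
  then show ?thesis by simp
qed

lemma vertical_strip_le:
  assumes "differ_by_vertical_strip lam mu"
  shows "mu i \<le> lam i + 1"
proof (rule ccontr)
  assume "\<not> mu i \<le> lam i + 1"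
  then have "(i, lam i) \<in> diagram mu - diagram lam" "(i, lam i + 1) \<in> diagram mu - diagram lam"
    by (auto simp: diagram_def)
  then have "lam i = lam i + 1"
    using assms unfolding differ_by_vertical_strip_def vertical_strip_def by blast
  then show False by simp
qed

lemma finite_UD: "finite (UD n h w)"
proof -
  let ?P = "{lam. \<forall>i. (i \<in> {..<h} \<longrightarrow> lam i \<in> {..w + 1}) \<and> (i \<notin> {..<h} \<longrightarrow> lam i = (0::nat))}"
  have "finite ?P" by (rule finite_set_of_finite_funs) auto
  then have "finite {T. set T \<subseteq> ?P \<and> length T = 2 * n + 1}" by (rule finite_lists_length_eq)
  moreover have "UD n h w \<subseteq> {T. set T \<subseteq> ?P \<and> length T = 2 * n + 1}"
  proof
    fix T assume T: "T \<in> UD n h w"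
    then have len: "length T = 2 * n + 1" by (simp add: UD_def)
    have part: "is_partition (T ! k)" if "k \<le> 2 * n" for k
      using T that len nth_mem[of k T] by (simp add: UD_def)
    have "diagram (T ! 0) = {}" using T by (simp add: UD_def)
    then have zero: "(T ! 0) i = 0" for i
      by (auto simp: diagram_def)
    have strip: "differ_by_vertical_strip (T ! (k - 1)) (T ! k)" if "k \<in> {1..2 * n}" for k
      using T that by (simp add: UD_def)
    have rows: "num_rows (T ! k) \<le> h" if "k \<in> {1..2 * n}" for k
      using T that by (simp add: UD_def)
    have cols: "num_columns (T ! (2 * k)) \<le> w" if "k \<in> {1..n}" for k
      using T that by (simp add: UD_def)
    have ev: "(T ! (2 * k)) i \<le> w" if "k \<le> n" for k i
    proof (cases "k = 0")
      case True
      then show ?thesis using zero by simp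
    next
      case False
      have "(T ! (2 * k)) i \<le> num_columns (T ! (2 * k))" using that by (intro le_columns part) simp
      also have "\<dots> \<le> w" using that False by (intro cols) simp
      finally show ?thesis .
    qed
    have bound: "(T ! k) i \<le> w + 1" if k: "k \<le> 2 * n" for k i
    proof (cases "even k")
      case True
      have "k div 2 \<le> n" using k by simp
      from ev[OF this, of i] True show ?thesis by simp
    next
      case False
      then obtain m where m: "k = 2 * m + 1" by (rule oddE)
      then have "differ_by_vertical_strip (T ! (2 * m)) (T ! k)"
        using strip[of k] k by simp
      from vertical_strip_le[OF this, of i] show ?thesis using ev[of m i] m k by simp
    qed
    have inP: "T ! k \<in> ?P" if k: "k \<le> 2 * n" for k
    proof (cases "k = 0")
      case True
      then show ?thesis using zero by simp
    next
      case False
      then have "num_rows (T ! k) \<le> h" using k by (intro rows) simp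
      then have "(T ! k) i = 0" if "h \<le> i" for i using that by (rule rows_le_D[OF part[OF k]])
      then show ?thesis using bound[OF k] by simp
    qed
    have "set T \<subseteq> ?P"
    proof
      fix lam assume "lam \<in> set T"
      then obtain k where "k < length T" "lam = T ! k" by (auto simp: in_set_conv_nth)
      then show "lam \<in> ?P" using inP[of k] len by simp
    qed
    then show "T \<in> {T. set T \<subseteq> ?P \<and> length T = 2 * n + 1}" using len by simp
  qed
  ultimately show ?thesis by (rule finite_subset[rotated])
qed

end

theory Submission
  imports Defs
begin

text \<open>
  Give a partition \<open>\<mu>\<close> with at most \<open>h\<close> rows the positions \<open>\<mu>\<^sub>h + 1 < \<mu>\<^sub>h\<^sub>-\<^sub>1 + 2 < \<dots> < \<mu>\<^sub>1 + h\<close>.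
  Adding or removing a vertical strip moves each of these \<open>h\<close> particles by at most one unit, and a
  family of moves is allowed iff no two particles collide, none reaches the wall \<open>0\<close>, and, after each
  pair of moves, none sits on the wall \<open>m = h + w + 1\<close>, which is the bound \<open>w\<close> on the columns.
  So an up-down tableau is a family of \<open>h\<close> nonintersecting walks from \<open>1, \<dots>, h\<close> to \<open>1, \<dots>, h\<close>
  between two walls.

  A single particle that goes up by \<open>0\<close> or \<open>1\<close> and then down by \<open>0\<close> or \<open>1\<close>, each unit having weight
  \<open>y = x\<^sub>k\<close>, has the transfer operator \<open>(1 + y\<^sup>2) + y (S + S\<^sup>-\<^sup>1)\<close> with \<open>S\<close> the unit shift. The numbers
  \<open>f\<^sub>r\<close> are the coefficients of \<open>\<Prod>\<^sub>k (1 + x\<^sub>k z) (1 + x\<^sub>k / z)\<close> and obey the same recurrence in \<open>k\<close>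
  (\<open>fsum_Suc\<close>), hence so do their periodizations with period \<open>N = 2 m\<close> and, by the reflection
  principle, the difference \<open>F\<^sub>-\<^sub>p\<^sub>+\<^sub>j - F\<^sub>p\<^sub>+\<^sub>j\<close>. That difference vanishes for \<open>p\<close> on either wall and starts
  as the identity matrix on \<open>{1, \<dots>, m - 1}\<close>.

  It remains to see that the determinant counts the noncolliding families. The rows of the determinant
  are indexed by particles. Expanding multilinearly, each row either stays or moves by one unit in a
  common direction (\<open>det_move_rows\<close>). Since the positions are strictly increasing integers, such a move
  leaves them weakly increasing, so a family with a collision has two equal rows and contributes \<open>0\<close>;
  a particle on a wall gives a zero row. An induction on the number of variables (\<open>det_reflected_eq_sum_tableaux_to\<close>) yields
  the determinant as the weighted sum over tableaux that end in a given partition.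
\<close>

section \<open>The periodized sums and their reflection\<close>

lemma esym_Suc: "esym (Suc n) x k = esym n x k + x (Suc n) * esym n x (k - 1)"
proof -
  let ?A = "{S. S \<subseteq> {1..n} \<and> int (card S) = k}"
  let ?B = "{S. S \<subseteq> {1..n} \<and> int (card S) = k - 1}"
  have fin: "finite S" "Suc n \<notin> S" if "S \<subseteq> {1..n}" for S
    using that finite_subset by auto
  have split: "{S. S \<subseteq> {1..Suc n} \<and> int (card S) = k} = ?A \<union> insert (Suc n) ` ?B" (is "?L = ?R")
  proof
    show "?L \<subseteq> ?R"
    proof
      fix S assume S: "S \<in> ?L"
      show "S \<in> ?R"
      proof (cases "Suc n \<in> S")
        case True
        have sub: "S - {Suc n} \<subseteq> {1..n}" using S by (auto simp: atLeastAtMostSuc_conv)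
        have "int (card (S - {Suc n})) = k - 1"
          using S True card_Suc_Diff1[of S "Suc n"] finite_subset[of S "{1..Suc n}"] by auto
        moreover have "S = insert (Suc n) (S - {Suc n})" using True by auto
        ultimately show ?thesis using sub by blast
      qed (use S in \<open>auto simp: atLeastAtMostSuc_conv\<close>)
    qed
    show "?R \<subseteq> ?L" using fin by (auto simp: atLeastAtMostSuc_conv)
  qed
  have inj: "inj_on (insert (Suc n)) ?B"
    by (rule inj_onI) (metis (mono_tags, lifting) fin(2) insert_ident mem_Collect_eq)
  have "esym (Suc n) x k = (\<Sum>S\<in>?A. \<Prod>i\<in>S. x i) + (\<Sum>S\<in>insert (Suc n) ` ?B. \<Prod>i\<in>S. x i)"
    unfolding esym_def split by (rule sum.union_disjoint) (use fin in auto)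
  also have "(\<Sum>S\<in>insert (Suc n) ` ?B. \<Prod>i\<in>S. x i) = (\<Sum>S\<in>?B. x (Suc n) * (\<Prod>i\<in>S. x i))"
    unfolding sum.reindex[OF inj] using fin by (intro sum.cong) auto
  finally show ?thesis by (simp add: esym_def sum_distrib_left)
qed

lemma Sum_any_shift: "Sum_any (\<lambda>i::int. f (i + c)) = Sum_any f"
proof -
  have "bij (\<lambda>i::int. i + c)" by (rule bij_betw_byWitness[where f' = "\<lambda>i. i - c"]) auto
  from Sum_any.reindex_cong[OF this, of f "\<lambda>i. f (i + c)"] show ?thesis by (simp add: comp_def)
qed

lemma Sum_any_esym_shift:
  "Sum_any (\<lambda>i. esym n x (i + a) * esym n x (i + b)) = fsum n x (b - a)"
  unfolding fsum_def by (subst Sum_any_shift[symmetric, of _ a]) (simp add: algebra_simps)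

lemma finite_support_esym_shift: "finite {i. esym n x (i + a) * esym n x (i + b) \<noteq> 0}"
proof (rule finite_subset)
  show "{i. esym n x (i + a) * esym n x (i + b) \<noteq> 0} \<subseteq> {- a..int n - a}"
  proof
    fix i assume "i \<in> {i. esym n x (i + a) * esym n x (i + b) \<noteq> 0}"
    then have "esym n x (i + a) \<noteq> 0" by auto
    then have "\<not> (i + a < 0 \<or> int n < i + a)" using esym_eq_0[of "i + a" n x] by blast
    then show "i \<in> {- a..int n - a}" by auto
  qed
qed simp

lemma finite_support_mult: "finite {i. f i \<noteq> 0} \<Longrightarrow> finite {i. c * f i \<noteq> (0::'a::mult_zero)}"
  by (rule finite_subset[of _ "{i. f i \<noteq> 0}"]) auto

lemma finite_support_add:
  "finite {i. f i \<noteq> 0} \<Longrightarrow> finite {i. g i \<noteq> 0} \<Longrightarrow> finite {i. f i + g i \<noteq> (0::'a::monoid_add)}"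
  by (rule finite_subset[of _ "{i. f i \<noteq> 0} \<union> {i. g i \<noteq> 0}"]) auto

text \<open>The generating function of the \<open>fsum n x r\<close> is the Laurent polynomial
  \<open>\<Prod>i. (1 + x i z) (1 + x i / z)\<close>, and each variable contributes the factor
  \<open>(1 + y\<^sup>2) + y (z + 1 / z)\<close>.\<close>

lemma fsum_Suc:
  fixes x :: "nat \<Rightarrow> 'a::comm_ring_1" and n :: nat
  defines "y \<equiv> x (Suc n)"
  shows "fsum (Suc n) x r = (1 + y\<^sup>2) * fsum n x r + y * (fsum n x (r - 1) + fsum n x (r + 1))"
proof -
  define t where "t = (\<lambda>a b i. esym n x (i + a) * esym n x (i + b))"
  have fin: "finite {i. t a b i \<noteq> 0}" for a b unfolding t_def by (rule finite_support_esym_shift)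
  have t: "Sum_any (t a b) = fsum n x (b - a)" for a b unfolding t_def by (rule Sum_any_esym_shift)
  note fins = finite_support_add finite_support_mult fin
  have "fsum (Suc n) x r
      = Sum_any (\<lambda>i. t 0 r i + (y\<^sup>2 * t (- 1) (r - 1) i + (y * t 0 (r - 1) i + y * t (- 1) r i)))"
    unfolding fsum_def
    by (rule Sum_any.cong) (simp add: esym_Suc y_def t_def algebra_simps power2_eq_square)
  also have "\<dots> = fsum n x r + (y\<^sup>2 * fsum n x r + (y * fsum n x (r - 1) + y * fsum n x (r + 1)))"
    by (simp add: Sum_any.distrib fins Sum_any_right_distrib[symmetric] t algebra_simps)
  finally show ?thesis by (simp add: algebra_simps)
qed

lemma Fsum_Suc:
  fixes x :: "nat \<Rightarrow> 'a::comm_ring_1" and n :: nat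
  assumes "N \<noteq> 0"
  defines "y \<equiv> x (Suc n)"
  shows "Fsum (Suc n) x r N = (1 + y\<^sup>2) * Fsum n x r N + y * (Fsum n x (r - 1) N + Fsum n x (r + 1) N)"
proof -
  have fin: "finite {k. fsum n x (s + N * k) \<noteq> 0}" for s by (rule finite_support_Fsum[OF assms(1)])
  note fins = finite_support_add finite_support_mult fin
  have "Fsum (Suc n) x r N = Sum_any (\<lambda>k. (1 + y\<^sup>2) * fsum n x (r + N * k)
      + (y * fsum n x (r - 1 + N * k) + y * fsum n x (r + 1 + N * k)))"
    unfolding Fsum_def by (rule Sum_any.cong) (simp add: fsum_Suc y_def algebra_simps)
  also have "\<dots> = (1 + y\<^sup>2) * Fsum n x r N + (y * Fsum n x (r - 1) N + y * Fsum n x (r + 1) N)"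
    unfolding Fsum_def by (simp only: Sum_any.distrib fins Sum_any_right_distrib[symmetric])
  finally show ?thesis by (simp add: algebra_simps)
qed

lemma Fsum_periodic: "Fsum n x (r + N) N = Fsum n x r N"
  unfolding Fsum_def
  by (subst Sum_any_shift[symmetric, of _ 1]) (simp add: algebra_simps)

lemma fsum_0: "fsum 0 x r = (if r = 0 then 1 else 0)"
proof -
  have e: "esym 0 x k = (if k = 0 then 1 else 0)" for k
  proof (cases "k = 0")
    case True
    have "{S. S \<subseteq> {1..0::nat} \<and> int (card S) = 0} = {{}}" by auto
    then show ?thesis unfolding esym_def True by simp
  next
    case False
    then have "k < 0 \<or> int 0 < k" by auto
    then show ?thesis using False by (simp only: esym_eq_0 if_False)
  qed
  have "fsum 0 x r = Sum_any (\<lambda>i. if i = 0 then (if i + r = 0 then 1 else 0) else 0)"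
    unfolding fsum_def by (rule Sum_any.cong) (simp add: e)
  also have "\<dots> = (if r = 0 then 1 else 0)" by (simp only: Sum_any.delta) simp
  finally show ?thesis .
qed

lemma Fsum_0:
  assumes "N \<noteq> 0"
  shows "Fsum 0 x r N = (if N dvd r then 1 else 0)"
proof (cases "N dvd r")
  case True
  then obtain q where q: "r = N * q" by blast
  have "Fsum 0 x r N = Sum_any (\<lambda>k. if k = - q then 1 else 0)"
    unfolding Fsum_def
  proof (rule Sum_any.cong)
    fix k
    have "r + N * k = N * (q + k)" by (simp add: q algebra_simps)
    then show "fsum 0 x (r + N * k) = (if k = - q then 1 else 0)"
      using assms by (auto simp: fsum_0)
  qed
  then show ?thesis using True by simp
next
  case False
  have "r + N * k \<noteq> 0" for k
  proof
    assume "r + N * k = 0"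
    then have "r = N * (- k)" by simp
    with False show False by simp
  qed
  then show ?thesis using False by (simp add: Fsum_def fsum_0)
qed

text \<open>The kernel of a walk from \<open>p\<close> to \<open>j\<close> that is killed at \<open>0\<close> and at \<open>N / 2\<close>, by the method of
  images: sources at \<open>p + N k\<close> and sinks at \<open>- p + N k\<close>.\<close>

definition reflected :: "int \<Rightarrow> nat \<Rightarrow> (nat \<Rightarrow> 'a) \<Rightarrow> int \<Rightarrow> int \<Rightarrow> 'a::comm_ring_1" where
  "reflected N n x p j = Fsum n x (- p + j) N - Fsum n x (p + j) N"

lemma reflected_wall_0: "reflected N n x 0 j = 0"
  by (simp add: reflected_def)

text \<open>Reflecting in \<open>m\<close> is reflecting in \<open>0\<close> followed by a translation by the period \<open>2 m\<close>.\<close>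

lemma reflected_wall_half_period:
  assumes "N = 2 * m"
  shows "reflected N n x m j = 0"
  using Fsum_periodic[of n x "- m + j" N] assms by (simp add: reflected_def algebra_simps)

lemma reflected_Suc:
  fixes x :: "nat \<Rightarrow> 'a::comm_ring_1" and n :: nat
  assumes "N \<noteq> 0"
  shows "reflected N (Suc n) x p j = (1 + (x (Suc n))\<^sup>2) * reflected N n x p j
    + x (Suc n) * (reflected N n x (p - 1) j + reflected N n x (p + 1) j)"
  unfolding reflected_def Fsum_Suc[OF assms] by (simp add: algebra_simps)

lemma reflected_0:
  assumes "N = 2 * m" "0 < p" "p < m" "0 < j" "j < m"
  shows "reflected N 0 x p j = (if p = j then 1 else 0)"
proof -
  have "\<not> N dvd p + j" using assms by (auto dest: zdvd_imp_le)
  moreover have "N dvd - p + j \<longleftrightarrow> p = j"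
  proof
    assume d: "N dvd - p + j"
    have "\<bar>- p + j\<bar> < N" using assms by linarith
    with d show "p = j" using dvd_imp_le_int[of "- p + j" N] by fastforce
  qed simp
  ultimately show ?thesis using assms by (simp add: reflected_def Fsum_0)
qed

section \<open>Moving the rows of a determinant\<close>

lemma det_add_rows:
  fixes A B :: "nat \<Rightarrow> nat \<Rightarrow> 'a::comm_ring_1"
  shows "det (mat h h (\<lambda>(a, b). A a b + y * B a b))
    = (\<Sum>Y\<in>Pow {..<h}. y ^ card Y * det (mat h h (\<lambda>(a, b). if a \<in> Y then B a b else A a b)))"
proof -
  have prod: "(\<Prod>a<h. A a (f a) + y * B a (f a))
      = (\<Sum>Y\<in>Pow {..<h}. y ^ card Y * (\<Prod>a<h. if a \<in> Y then B a (f a) else A a (f a)))" for f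
  proof -
    have "(\<Prod>a<h. A a (f a) + y * B a (f a)) = (\<Prod>a<h. y * B a (f a) + A a (f a))"
      by (simp add: add.commute)
    also have "\<dots> = (\<Sum>Y\<in>Pow {..<h}. (\<Prod>a\<in>Y. y * B a (f a)) * (\<Prod>a\<in>{..<h} - Y. A a (f a)))"
      by (rule prod_add) simp
    also have "\<dots> = (\<Sum>Y\<in>Pow {..<h}. y ^ card Y * (\<Prod>a<h. if a \<in> Y then B a (f a) else A a (f a)))"
    proof (rule sum.cong[OF refl])
      fix Y assume "Y \<in> Pow {..<h}"
      then have "{..<h} \<inter> Y = Y" "{..<h} \<inter> - Y = {..<h} - Y" by auto
      then show "(\<Prod>a\<in>Y. y * B a (f a)) * (\<Prod>a\<in>{..<h} - Y. A a (f a))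
          = y ^ card Y * (\<Prod>a<h. if a \<in> Y then B a (f a) else A a (f a))"
        by (simp add: prod.If_cases prod.distrib mult.assoc)
    qed
    finally show ?thesis .
  qed
  have leibniz: "det (mat h h (\<lambda>(a, b). M a b))
      = (\<Sum>f | f permutes {0..<h}. signof f * (\<Prod>a<h. M a (f a)))" for M :: "nat \<Rightarrow> nat \<Rightarrow> 'a"
    by (simp add: det_def'[of _ h] atLeast0LessThan permutes_in_image)
  show ?thesis
    \<comment> \<open>In every term of the Leibniz expansion the product over the rows is distributed over the sets
      \<open>Y\<close> of rows that use the second summand.\<close>
    unfolding leibniz prod sum_distrib_left
    by (subst sum.swap) (simp add: mult.left_commute sum_distrib_left)
qed

lemma det_eq_0_if_rows_eq:
  fixes M :: "nat \<Rightarrow> nat \<Rightarrow> 'a::comm_ring_1"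
  assumes "a < h" "a' < h" "a \<noteq> a'" "M a = M a'"
  shows "det (mat h h (\<lambda>(a, b). M a b)) = 0"
  using assms by (intro det_identical_rows[of _ h a a']) (auto intro!: eq_vecI)

lemma det_eq_0_if_row_0:
  fixes M :: "nat \<Rightarrow> nat \<Rightarrow> 'a::comm_ring_1"
  assumes "a < h" "\<And>b. b < h \<Longrightarrow> M a b = 0"
  shows "det (mat h h (\<lambda>(a, b). M a b)) = 0"
proof -
  have "(\<Prod>a = 0..<h. M a (f a)) = 0" if "f permutes {0..<h}" for f
  proof (rule prod_zero)
    have "f a < h" using that assms(1) permutes_in_image[of f "{0..<h}" a] by simp
    then show "\<exists>a\<in>{0..<h}. M a (f a) = 0" using assms by (intro bexI[of _ a]) auto
  qed simp
  then show ?thesis by (simp add: det_def'[of _ h] permutes_in_image)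
qed

text \<open>A step of \<open>\<epsilon> = \<plusminus>1\<close> cannot reverse the order of two distinct integers, it can only make them
  equal. So a choice \<open>Y\<close> of moving rows that destroys strict monotonicity produces two equal rows.\<close>

lemma det_move_rows:
  fixes B :: "int \<Rightarrow> nat \<Rightarrow> 'a::comm_ring_1" and \<epsilon> :: int
  defines "q \<equiv> \<lambda>p Y a. p a + (if a \<in> Y then \<epsilon> else 0)"
  assumes p: "strict_mono_on {..<h} p" and \<epsilon>: "\<epsilon> = 1 \<or> \<epsilon> = - 1"
  shows "det (mat h h (\<lambda>(a, b). B (p a) b + y * B (p a + \<epsilon>) b))
    = (\<Sum>Y | Y \<subseteq> {..<h} \<and> strict_mono_on {..<h} (q p Y).
        y ^ card Y * det (mat h h (\<lambda>(a, b). B (q p Y a) b)))"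
proof -
  have "det (mat h h (\<lambda>(a, b). B (p a) b + y * B (p a + \<epsilon>) b))
      = (\<Sum>Y\<in>Pow {..<h}. y ^ card Y * det (mat h h (\<lambda>(a, b). B (q p Y a) b)))"
    unfolding det_add_rows q_def by (simp only: if_distrib[of "\<lambda>e. B (_ + e) _"] add_0_right)
  also have "\<dots> = (\<Sum>Y | Y \<subseteq> {..<h} \<and> strict_mono_on {..<h} (q p Y).
        y ^ card Y * det (mat h h (\<lambda>(a, b). B (q p Y a) b)))"
  proof (rule sum.mono_neutral_right)
    show "\<forall>Y\<in>Pow {..<h} - {Y. Y \<subseteq> {..<h} \<and> strict_mono_on {..<h} (q p Y)}.
        y ^ card Y * det (mat h h (\<lambda>(a, b). B (q p Y a) b)) = 0"
    proof
      fix Y assume "Y \<in> Pow {..<h} - {Y. Y \<subseteq> {..<h} \<and> strict_mono_on {..<h} (q p Y)}"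
      then obtain a a' where a: "a < h" "a' < h" "a < a'" "\<not> q p Y a < q p Y a'"
        by (auto simp: monotone_on_def)
      have "p a < p a'" using p a by (auto simp: monotone_on_def)
      then have "q p Y a = q p Y a'" using a \<epsilon> by (auto simp: q_def split: if_splits)
      then have "det (mat h h (\<lambda>(a, b). B (q p Y a) b)) = 0"
        using a by (intro det_eq_0_if_rows_eq[of a h a']) auto
      then show "y ^ card Y * det (mat h h (\<lambda>(a, b). B (q p Y a) b)) = 0" by simp
    qed
  qed auto
  finally show ?thesis .
qed

section \<open>Partitions as strictly increasing positions\<close>

definition partitions :: "nat \<Rightarrow> (nat \<Rightarrow> nat) set" where
  "partitions h = {\<mu>. antimono \<mu> \<and> (\<forall>i\<ge>h. \<mu> i = 0)}"

text \<open>Rows are read from the bottom of the diagram, so that \<open>pos h \<mu>\<close> is increasing and the empty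
  partition has positions \<open>1, \<dots>, h\<close> in this order.\<close>

definition pos :: "nat \<Rightarrow> (nat \<Rightarrow> nat) \<Rightarrow> nat \<Rightarrow> int" where
  "pos h \<mu> a = int (\<mu> (h - Suc a)) + int a + 1"

lemma partitions_support: "\<mu> \<in> partitions h \<Longrightarrow> 0 < \<mu> i \<Longrightarrow> i < h"
  by (rule ccontr) (simp add: partitions_def)

lemma pos_strict_mono:
  assumes "\<mu> \<in> partitions h"
  shows "strict_mono_on {..<h} (pos h \<mu>)"
proof (rule strict_mono_onI)
  fix a b assume "a \<in> {..<h}" "b \<in> {..<h}" "a < b"
  moreover have "\<mu> (h - Suc a) \<le> \<mu> (h - Suc b)"
    using assms \<open>a < b\<close> by (intro antimonoD[of \<mu>]) (auto simp: partitions_def)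
  ultimately show "pos h \<mu> a < pos h \<mu> b" by (simp add: pos_def)
qed

lemma pos_ge_1: "1 \<le> pos h \<mu> a"
  by (simp add: pos_def)

lemma pos_inj:
  assumes "\<mu> \<in> partitions h" "\<nu> \<in> partitions h" "\<And>a. a < h \<Longrightarrow> pos h \<mu> a = pos h \<nu> a"
  shows "\<mu> = \<nu>"
proof
  fix i
  show "\<mu> i = \<nu> i"
  proof (cases "i < h")
    case True
    then show ?thesis using assms(3)[of "h - Suc i"] by (simp add: pos_def Suc_diff_Suc)
  qed (use assms in \<open>simp add: partitions_def\<close>)
qed

lemma strict_mono_on_int_gap:
  fixes q :: "nat \<Rightarrow> int"
  assumes q: "strict_mono_on {..<h} q" and "a \<le> b" "b < h"
  shows "q a + int (b - a) \<le> q b"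
  using assms(2,3)
proof (induction b rule: dec_induct)
  case (step b)
  then have "q b < q (Suc b)" using q by (auto simp: monotone_on_def)
  moreover have "q a + int (b - a) \<le> q b" using step by simp
  ultimately show ?case using step by (simp add: Suc_diff_le)
qed simp

text \<open>Strictly increasing positive integers satisfy \<open>q a \<ge> a + 1\<close>, so that subtracting \<open>a + 1\<close> leaves
  the rows of a partition.\<close>

lemma pos_surj:
  assumes q: "strict_mono_on {..<h} q" and q1: "\<And>a. a < h \<Longrightarrow> 1 \<le> q a"
  obtains \<mu> where "\<mu> \<in> partitions h" "\<And>a. a < h \<Longrightarrow> pos h \<mu> a = q a"
proof
  define \<mu> where "\<mu> = (\<lambda>i. if i < h then nat (q (h - Suc i) - int (h - i)) else 0)"
  have ge: "int (Suc a) \<le> q a" if "a < h" for a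
    using strict_mono_on_int_gap[OF q, of 0 a] q1[of 0] that by simp
  have "\<mu> j \<le> \<mu> i" if "i \<le> j" for i j
  proof (cases "j < h")
    case True
    have "q (h - Suc j) + int (j - i) \<le> q (h - Suc i)"
      using strict_mono_on_int_gap[OF q, of "h - Suc j" "h - Suc i"] True that by simp
    then show ?thesis using True that by (auto simp: \<mu>_def of_nat_diff intro!: nat_mono)
  qed (simp add: \<mu>_def)
  then show "\<mu> \<in> partitions h" by (auto simp: partitions_def \<mu>_def intro: antimonoI)
  show "pos h \<mu> a = q a" if "a < h" for a
    using ge[OF that] that by (simp add: pos_def \<mu>_def Suc_diff_Suc)
qed

lemma psize_eq_sum:
  assumes "\<mu> \<in> partitions h"
  shows "psize \<mu> = (\<Sum>i<h. \<mu> i)"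
  unfolding psize_def using assms
  by (intro sum.mono_neutral_left) (auto dest: partitions_support)

text \<open>For \<open>\<epsilon> = 1\<close> a vertical strip is added, for \<open>\<epsilon> = - 1\<close> it is removed.\<close>

definition vstrip_moves :: "nat \<Rightarrow> int \<Rightarrow> (nat \<Rightarrow> nat) \<Rightarrow> (nat \<Rightarrow> nat) set" where
  "vstrip_moves h \<epsilon> \<mu> = {\<nu> \<in> partitions h. \<forall>i. int (\<nu> i) = int (\<mu> i) \<or> int (\<nu> i) = int (\<mu> i) + \<epsilon>}"

lemma vstrip_moves_up: "\<kappa> \<in> vstrip_moves h 1 \<mu> \<Longrightarrow> \<mu> i \<le> \<kappa> i \<and> \<kappa> i \<le> \<mu> i + 1"
  unfolding vstrip_moves_def by (drule CollectD, elim conjE, drule spec[of _ i]) linarith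

lemma vstrip_moves_down: "\<nu> \<in> vstrip_moves h (- 1) \<kappa> \<Longrightarrow> \<nu> i \<le> \<kappa> i"
  unfolding vstrip_moves_def by (drule CollectD, elim conjE, drule spec[of _ i]) linarith

text \<open>The sets of moving rows that survive in \<open>det_move_rows\<close> are exactly the vertical strips. For
  \<open>\<epsilon> = - 1\<close> a particle may also step onto the wall \<open>0\<close>, where no partition corresponds to it; this is
  why \<open>B\<close> must vanish there.\<close>

lemma det_pos_half_step:
  fixes B :: "int \<Rightarrow> nat \<Rightarrow> 'a::comm_ring_1"
  assumes \<mu>: "\<mu> \<in> partitions h"
    and \<epsilon>: "\<epsilon> = 1 \<or> \<epsilon> = - 1 \<and> (\<forall>b<h. B 0 b = 0)"
  shows "det (mat h h (\<lambda>(a, b). B (pos h \<mu> a) b + y * B (pos h \<mu> a + \<epsilon>) b))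
    = (\<Sum>\<nu>\<in>vstrip_moves h \<epsilon> \<mu>. y ^ nat (\<epsilon> * (int (psize \<nu>) - int (psize \<mu>)))
        * det (mat h h (\<lambda>(a, b). B (pos h \<nu> a) b)))"
proof -
  define q where "q = (\<lambda>p Y (a::nat). p a + (if a \<in> Y then \<epsilon> else (0::int)))"
  let ?p = "pos h \<mu>"
  let ?Z = "{Y. Y \<subseteq> {..<h} \<and> strict_mono_on {..<h} (q ?p Y)}"
  let ?Z1 = "{Y \<in> ?Z. \<forall>a<h. 1 \<le> q ?p Y a}"
  let ?F = "\<lambda>Y. y ^ card Y * det (mat h h (\<lambda>(a, b). B (q ?p Y a) b))"
  define moved where "moved = (\<lambda>\<nu>. {a. a < h \<and> pos h \<nu> a \<noteq> ?p a})"
  have \<epsilon>0: "\<epsilon> = 1 \<or> \<epsilon> = - 1" using \<epsilon> by auto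
  have q_moved: "q ?p (moved \<nu>) a = pos h \<nu> a" if "\<nu> \<in> vstrip_moves h \<epsilon> \<mu>" "a < h" for \<nu> a
  proof -
    have "int (\<nu> (h - Suc a)) = int (\<mu> (h - Suc a)) \<or> int (\<nu> (h - Suc a)) = int (\<mu> (h - Suc a)) + \<epsilon>"
      using that by (simp add: vstrip_moves_def)
    then show ?thesis using that by (auto simp: q_def moved_def pos_def)
  qed
  have card: "card (moved \<nu>) = nat (\<epsilon> * (int (psize \<nu>) - int (psize \<mu>)))"
    if \<nu>: "\<nu> \<in> vstrip_moves h \<epsilon> \<mu>" for \<nu>
  proof -
    have "\<nu> \<in> partitions h" using \<nu> by (simp add: vstrip_moves_def)
    then have "int (psize \<nu>) - int (psize \<mu>) = (\<Sum>i<h. int (\<nu> i) - int (\<mu> i))"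
      using \<mu> by (simp add: psize_eq_sum sum_subtractf)
    also have "\<dots> = (\<Sum>a<h. pos h \<nu> a - ?p a)"
      by (subst sum.nat_diff_reindex[symmetric]) (simp add: pos_def)
    also have "\<dots> = (\<Sum>a<h. if a \<in> moved \<nu> then \<epsilon> else 0)"
      using q_moved[OF \<nu>] by (intro sum.cong) (auto simp: q_def algebra_simps split: if_splits)
    also have "\<dots> = int (card ({..<h} \<inter> moved \<nu>)) * \<epsilon>"
      by (simp add: sum.If_cases Int_def)
    also have "{..<h} \<inter> moved \<nu> = moved \<nu>" by (auto simp: moved_def)
    finally show ?thesis using \<epsilon>0 by auto
  qed
  have "det (mat h h (\<lambda>(a, b). B (?p a) b + y * B (?p a + \<epsilon>) b)) = sum ?F ?Z"
    unfolding q_def by (rule det_move_rows[OF pos_strict_mono[OF \<mu>] \<epsilon>0])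
  also have "\<dots> = sum ?F ?Z1"
  proof (rule sum.mono_neutral_right)
    show "\<forall>Y\<in>?Z - ?Z1. ?F Y = 0"
    proof
      fix Y assume "Y \<in> ?Z - ?Z1"
      then obtain a where a: "a < h" "q ?p Y a < 1" by (auto simp: not_le)
      then have "q ?p Y a = 0" "\<epsilon> = - 1" using pos_ge_1[of h \<mu> a] \<epsilon>0 by (auto simp: q_def split: if_splits)
      then have "det (mat h h (\<lambda>(a, b). B (q ?p Y a) b)) = 0"
        using a \<epsilon> by (intro det_eq_0_if_row_0[of a]) auto
      then show "?F Y = 0" by simp
    qed
  qed auto
  also have "\<dots> = (\<Sum>\<nu>\<in>vstrip_moves h \<epsilon> \<mu>. ?F (moved \<nu>))"
  proof (rule sum.reindex_bij_betw[symmetric], rule bij_betw_imageI)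
    show "inj_on moved (vstrip_moves h \<epsilon> \<mu>)"
    proof (rule inj_onI)
      fix \<nu> \<nu>' assume \<nu>: "\<nu> \<in> vstrip_moves h \<epsilon> \<mu>" "\<nu>' \<in> vstrip_moves h \<epsilon> \<mu>" "moved \<nu> = moved \<nu>'"
      show "\<nu> = \<nu>'"
        by (rule pos_inj[of _ h]) (use \<nu> q_moved[OF \<nu>(1)] q_moved[OF \<nu>(2)] in \<open>auto simp: vstrip_moves_def\<close>)
    qed
    show "moved ` vstrip_moves h \<epsilon> \<mu> = ?Z1"
    proof (intro equalityI subsetI)
      fix Y assume "Y \<in> moved ` vstrip_moves h \<epsilon> \<mu>"
      then obtain \<nu> where \<nu>: "\<nu> \<in> vstrip_moves h \<epsilon> \<mu>" "Y = moved \<nu>" by blast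
      then have "\<nu> \<in> partitions h" by (simp add: vstrip_moves_def)
      then have "strict_mono_on {..<h} (q ?p Y)"
        using pos_strict_mono[of \<nu> h] q_moved[OF \<nu>(1)] \<nu>(2) by (simp add: monotone_on_def)
      then show "Y \<in> ?Z1"
        using q_moved[OF \<nu>(1)] \<nu>(2) pos_ge_1 by (auto simp: moved_def)
    next
      fix Y assume Y: "Y \<in> ?Z1"
      then obtain \<nu> where \<nu>: "\<nu> \<in> partitions h" "\<And>a. a < h \<Longrightarrow> pos h \<nu> a = q ?p Y a"
        using pos_surj[of h "q ?p Y"] by auto
      have "int (\<nu> i) = int (\<mu> i) \<or> int (\<nu> i) = int (\<mu> i) + \<epsilon>" for i
      proof (cases "i < h")
        case True
        then show ?thesis using \<nu>(2)[of "h - Suc i"]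
          by (auto simp: q_def pos_def Suc_diff_Suc split: if_splits)
      qed (use \<nu> \<mu> in \<open>simp add: partitions_def\<close>)
      then have "\<nu> \<in> vstrip_moves h \<epsilon> \<mu>" using \<nu> by (simp add: vstrip_moves_def)
      moreover have "Y = moved \<nu>" using Y \<nu>(2) \<epsilon>0 by (auto simp: moved_def q_def split: if_splits)
      ultimately show "Y \<in> moved ` vstrip_moves h \<epsilon> \<mu>" by blast
    qed
  qed
  also have "\<dots> = (\<Sum>\<nu>\<in>vstrip_moves h \<epsilon> \<mu>. y ^ nat (\<epsilon> * (int (psize \<nu>) - int (psize \<mu>)))
        * det (mat h h (\<lambda>(a, b). B (pos h \<nu> a) b)))"
  proof (rule sum.cong[OF refl])
    fix \<nu> assume \<nu>: "\<nu> \<in> vstrip_moves h \<epsilon> \<mu>"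
    have "mat h h (\<lambda>(a, b). B (q ?p (moved \<nu>) a) b) = mat h h (\<lambda>(a, b). B (pos h \<nu> a) b)"
      by (rule cong_mat) (simp_all add: q_moved[OF \<nu>])
    then show "?F (moved \<nu>) = y ^ nat (\<epsilon> * (int (psize \<nu>) - int (psize \<mu>)))
        * det (mat h h (\<lambda>(a, b). B (pos h \<nu> a) b))" by (simp add: card[OF \<nu>])
  qed
  finally show ?thesis .
qed

lemma finite_vstrip_moves: "finite (vstrip_moves h \<epsilon> \<mu>)"
proof (rule finite_subset)
  let ?P = "{\<nu>. \<forall>i. (i \<in> {..<h} \<longrightarrow> \<nu> i \<in> {..Max (\<mu> ` {..<h}) + nat \<bar>\<epsilon>\<bar>}) \<and> (i \<notin> {..<h} \<longrightarrow> \<nu> i = (0::nat))}"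
  show "finite ?P" by (rule finite_set_of_finite_funs) auto
  show "vstrip_moves h \<epsilon> \<mu> \<subseteq> ?P"
  proof
    fix \<nu> assume \<nu>: "\<nu> \<in> vstrip_moves h \<epsilon> \<mu>"
    have "\<nu> i \<le> Max (\<mu> ` {..<h}) + nat \<bar>\<epsilon>\<bar>" if "i < h" for i
    proof -
      have "\<mu> i \<le> Max (\<mu> ` {..<h})" using that by (intro Max_ge) auto
      moreover have "int (\<nu> i) = int (\<mu> i) \<or> int (\<nu> i) = int (\<mu> i) + \<epsilon>"
        using \<nu> by (simp add: vstrip_moves_def)
      ultimately show ?thesis by linarith
    qed
    then show "\<nu> \<in> ?P" using \<nu> by (auto simp: vstrip_moves_def partitions_def)
  qed
qed

text \<open>Read backwards, a step of the tableau goes from \<open>\<mu> = \<lambda>\<^sup>2\<^sup>i\<close> up to \<open>\<kappa> = \<lambda>\<^sup>2\<^sup>i\<^sup>-\<^sup>1\<close> and down to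
  \<open>\<nu> = \<lambda>\<^sup>2\<^sup>i\<^sup>-\<^sup>2\<close>. The bound on the columns is imposed on \<open>\<nu>\<close> only: \<open>\<kappa>\<close> may have one more,
  and \<open>\<mu>\<close> is either the \<open>\<nu>\<close> of the following step or the last partition.\<close>

definition peaks :: "nat \<Rightarrow> nat \<Rightarrow> (nat \<Rightarrow> nat) \<Rightarrow> ((nat \<Rightarrow> nat) \<times> (nat \<Rightarrow> nat)) set" where
  "peaks h w \<mu> = (SIGMA \<kappa>:vstrip_moves h 1 \<mu>. {\<nu> \<in> vstrip_moves h (- 1) \<kappa>. \<nu> 0 \<le> w})"

lemma finite_peaks: "finite (peaks h w \<mu>)"
  unfolding peaks_def
  by (intro finite_SigmaI) (simp_all add: finite_vstrip_moves)

text \<open>The transfer operator factors as \<open>(1 + y S) (1 + y S\<^sup>-\<^sup>1)\<close>, one factor for the strip that is added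
  and one for the strip that is removed. The second wall acts only after both half steps: the largest
  particle may visit \<open>h + w + 1\<close> in between, and the terms in which it stays there have a zero row.\<close>

lemma det_pos_step:
  fixes B :: "int \<Rightarrow> nat \<Rightarrow> 'a::comm_ring_1"
  assumes h: "h > 0" and \<mu>: "\<mu> \<in> partitions h" "\<mu> 0 \<le> w"
    and walls: "\<And>b. b < h \<Longrightarrow> B 0 b = 0" "\<And>b. b < h \<Longrightarrow> B (int h + int w + 1) b = 0"
  shows "det (mat h h (\<lambda>(a, b). (1 + y\<^sup>2) * B (pos h \<mu> a) b
        + y * (B (pos h \<mu> a - 1) b + B (pos h \<mu> a + 1) b)))
    = (\<Sum>(\<kappa>, \<nu>)\<in>peaks h w \<mu>. y ^ nat (- int (psize \<nu>) + 2 * int (psize \<kappa>) - int (psize \<mu>))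
        * det (mat h h (\<lambda>(a, b). B (pos h \<nu> a) b)))"
proof -
  define C where "C = (\<lambda>p b. B p b + y * B (p + (- 1)) b)"
  let ?e = "\<lambda>\<epsilon> \<nu> \<mu>. nat (\<epsilon> * (int (psize \<nu>) - int (psize \<mu>)))"
  let ?D = "\<lambda>\<nu>. det (mat h h (\<lambda>(a, b). B (pos h \<nu> a) b))"
  have down: "det (mat h h (\<lambda>(a, b). C (pos h \<kappa> a) b))
      = (\<Sum>\<nu> | \<nu> \<in> vstrip_moves h (- 1) \<kappa> \<and> \<nu> 0 \<le> w. y ^ ?e (- 1) \<nu> \<kappa> * ?D \<nu>)"
    if \<kappa>: "\<kappa> \<in> vstrip_moves h 1 \<mu>" for \<kappa>
  proof -
    have part: "\<kappa> \<in> partitions h" using \<kappa> by (simp add: vstrip_moves_def)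
    have "det (mat h h (\<lambda>(a, b). C (pos h \<kappa> a) b))
        = (\<Sum>\<nu>\<in>vstrip_moves h (- 1) \<kappa>. y ^ ?e (- 1) \<nu> \<kappa> * ?D \<nu>)"
      unfolding C_def using walls(1) by (intro det_pos_half_step part) auto
    also have "\<dots> = (\<Sum>\<nu> | \<nu> \<in> vstrip_moves h (- 1) \<kappa> \<and> \<nu> 0 \<le> w. y ^ ?e (- 1) \<nu> \<kappa> * ?D \<nu>)"
    proof (rule sum.mono_neutral_right)
      show "\<forall>\<nu>\<in>vstrip_moves h (- 1) \<kappa> - {\<nu>. \<nu> \<in> vstrip_moves h (- 1) \<kappa> \<and> \<nu> 0 \<le> w}.
          y ^ ?e (- 1) \<nu> \<kappa> * ?D \<nu> = 0"
      proof
        fix \<nu> assume "\<nu> \<in> vstrip_moves h (- 1) \<kappa> - {\<nu>. \<nu> \<in> vstrip_moves h (- 1) \<kappa> \<and> \<nu> 0 \<le> w}"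
        then have \<nu>: "\<nu> \<in> vstrip_moves h (- 1) \<kappa>" "w < \<nu> 0" by auto
        have "\<nu> 0 = w + 1"
          using vstrip_moves_down[OF \<nu>(1), of 0] vstrip_moves_up[OF \<kappa>, of 0] \<mu>(2) \<nu>(2) by linarith
        then have "pos h \<nu> (h - 1) = int h + int w + 1" using h by (simp add: pos_def)
        then have "?D \<nu> = 0" using h walls(2) by (intro det_eq_0_if_row_0[of "h - 1"]) auto
        then show "y ^ ?e (- 1) \<nu> \<kappa> * ?D \<nu> = 0" by simp
      qed
    qed (auto intro: finite_vstrip_moves)
    finally show ?thesis .
  qed
  have factor: "(1 + y\<^sup>2) * B p b + y * (B (p - 1) b + B (p + 1) b) = C p b + y * C (p + 1) b" for p b
    by (simp add: C_def distrib_left distrib_right power2_eq_square mult.assoc add_ac)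
  have "det (mat h h (\<lambda>(a, b). (1 + y\<^sup>2) * B (pos h \<mu> a) b
        + y * (B (pos h \<mu> a - 1) b + B (pos h \<mu> a + 1) b)))
      = det (mat h h (\<lambda>(a, b). C (pos h \<mu> a) b + y * C (pos h \<mu> a + 1) b))"
    by (simp only: factor)
  also have "\<dots> = (\<Sum>\<kappa>\<in>vstrip_moves h 1 \<mu>. y ^ ?e 1 \<kappa> \<mu> * det (mat h h (\<lambda>(a, b). C (pos h \<kappa> a) b)))"
    by (rule det_pos_half_step[OF \<mu>(1)]) simp
  also have "\<dots> = (\<Sum>\<kappa>\<in>vstrip_moves h 1 \<mu>. \<Sum>\<nu> | \<nu> \<in> vstrip_moves h (- 1) \<kappa> \<and> \<nu> 0 \<le> w.
      y ^ nat (- int (psize \<nu>) + 2 * int (psize \<kappa>) - int (psize \<mu>)) * ?D \<nu>)"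
  proof (rule sum.cong[OF refl])
    fix \<kappa> assume \<kappa>: "\<kappa> \<in> vstrip_moves h 1 \<mu>"
    have "y ^ ?e 1 \<kappa> \<mu> * (y ^ ?e (- 1) \<nu> \<kappa> * ?D \<nu>)
        = y ^ nat (- int (psize \<nu>) + 2 * int (psize \<kappa>) - int (psize \<mu>)) * ?D \<nu>"
      if \<nu>: "\<nu> \<in> vstrip_moves h (- 1) \<kappa>" for \<nu>
    proof -
      have part: "\<kappa> \<in> partitions h" "\<nu> \<in> partitions h" using \<kappa> \<nu> by (auto simp: vstrip_moves_def)
      have "\<mu> i \<le> \<kappa> i" "\<nu> i \<le> \<kappa> i" for i
        using vstrip_moves_up[OF \<kappa>] vstrip_moves_down[OF \<nu>] by simp_all
      then have "psize \<mu> \<le> psize \<kappa>" "psize \<nu> \<le> psize \<kappa>"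
        using part \<mu> by (auto simp: psize_eq_sum intro!: sum_mono)
      then have "?e 1 \<kappa> \<mu> + ?e (- 1) \<nu> \<kappa> = nat (- int (psize \<nu>) + 2 * int (psize \<kappa>) - int (psize \<mu>))"
        by (subst nat_add_distrib[symmetric]) simp_all
      then show ?thesis by (simp only: mult.assoc[symmetric] power_add[symmetric])
    qed
    note e = this
    show "y ^ ?e 1 \<kappa> \<mu> * det (mat h h (\<lambda>(a, b). C (pos h \<kappa> a) b))
        = (\<Sum>\<nu> | \<nu> \<in> vstrip_moves h (- 1) \<kappa> \<and> \<nu> 0 \<le> w.
            y ^ nat (- int (psize \<nu>) + 2 * int (psize \<kappa>) - int (psize \<mu>)) * ?D \<nu>)"
      unfolding down[OF \<kappa>] sum_distrib_left by (intro sum.cong refl e) blast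
  qed
  also have "\<dots> = (\<Sum>(\<kappa>, \<nu>)\<in>peaks h w \<mu>.
      y ^ nat (- int (psize \<nu>) + 2 * int (psize \<kappa>) - int (psize \<mu>)) * ?D \<nu>)"
    unfolding peaks_def
    by (rule sum.Sigma) (simp_all add: finite_vstrip_moves)
  finally show ?thesis .
qed

section \<open>Tableaux built peak by peak\<close>

text \<open>The up-down tableaux with an arbitrary last partition, the form that admits an induction on the
  length.\<close>

definition tableaux_to :: "nat \<Rightarrow> nat \<Rightarrow> nat \<Rightarrow> (nat \<Rightarrow> nat) \<Rightarrow> (nat \<Rightarrow> nat) list set" where
  "tableaux_to h w k \<mu> = {T. length T = 2 * k + 1 \<and> T ! 0 = (\<lambda>_. 0) \<and> T ! (2 * k) = \<mu> \<and>
     (\<forall>i<k. (T ! (2 * i + 1), T ! (2 * i)) \<in> peaks h w (T ! (2 * i + 2)))}"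

lemma tableaux_to_0: "tableaux_to h w 0 \<mu> = (if \<mu> = (\<lambda>_. 0) then {[\<mu>]} else {})"
proof -
  have "T = [\<mu>]" if "length T = 1" "T ! 0 = \<mu>" for T :: "(nat \<Rightarrow> nat) list"
    using that by (cases T) auto
  then show ?thesis by (auto simp: tableaux_to_def)
qed

lemma tableaux_to_Suc:
  "tableaux_to h w (Suc k) \<mu>
    = (\<lambda>((\<kappa>, \<nu>), T). T @ [\<kappa>, \<mu>]) ` (SIGMA z:peaks h w \<mu>. tableaux_to h w k (snd z))"
proof (intro equalityI subsetI)
  fix T assume T: "T \<in> tableaux_to h w (Suc k) \<mu>"
  let ?S = "take (2 * k + 1) T"
  have len: "length T = 2 * k + 3" using T by (simp add: tableaux_to_def)
  have "T = ?S @ [T ! (2 * k + 1), T ! (2 * k + 2)]"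
    using len Cons_nth_drop_Suc[of "2 * k + 1" T] Cons_nth_drop_Suc[of "2 * k + 2" T]
      append_take_drop_id[of "2 * k + 1" T] by simp
  moreover have "T ! (2 * k + 2) = \<mu>" using T by (simp add: tableaux_to_def)
  moreover have "(T ! (2 * k + 1), T ! (2 * k)) \<in> peaks h w \<mu>"
    using T by (auto simp: tableaux_to_def)
  moreover have "?S \<in> tableaux_to h w k (T ! (2 * k))"
    using T by (auto simp: tableaux_to_def)
  ultimately show "T \<in> (\<lambda>((\<kappa>, \<nu>), T). T @ [\<kappa>, \<mu>]) ` (SIGMA z:peaks h w \<mu>. tableaux_to h w k (snd z))"
    by (intro image_eqI[of _ _ "((T ! (2 * k + 1), T ! (2 * k)), ?S)"]) auto
next
  fix T assume "T \<in> (\<lambda>((\<kappa>, \<nu>), T). T @ [\<kappa>, \<mu>]) ` (SIGMA z:peaks h w \<mu>. tableaux_to h w k (snd z))"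
  then obtain \<kappa> \<nu> S where S: "T = S @ [\<kappa>, \<mu>]" "(\<kappa>, \<nu>) \<in> peaks h w \<mu>" "S \<in> tableaux_to h w k \<nu>"
    by auto
  then show "T \<in> tableaux_to h w (Suc k) \<mu>"
    by (auto simp: tableaux_to_def nth_append less_Suc_eq)
qed

lemma finite_tableaux_to: "finite (tableaux_to h w k \<mu>)"
proof (induction k arbitrary: \<mu>)
  case (Suc k)
  then show ?case unfolding tableaux_to_Suc by (intro finite_imageI finite_SigmaI finite_peaks) auto
qed (simp add: tableaux_to_0)

lemma weight_Suc:
  assumes "length S = 2 * k + 1"
  shows "weight (Suc k) x (S @ [\<kappa>, \<mu>]) = x (Suc k) ^
     nat (- int (psize (S ! (2 * k))) + 2 * int (psize \<kappa>) - int (psize \<mu>)) * weight k x S"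
proof -
  have "weight (Suc k) x (S @ [\<kappa>, \<mu>]) = weight k x (S @ [\<kappa>, \<mu>]) * x (Suc k) ^
     nat (- int (psize (S ! (2 * k))) + 2 * int (psize \<kappa>) - int (psize \<mu>))"
    using assms by (simp add: weight_def nth_append)
  moreover have "weight k x (S @ [\<kappa>, \<mu>]) = weight k x S"
    unfolding weight_def by (rule prod.cong) (use assms in \<open>auto simp: nth_append\<close>)
  ultimately show ?thesis by (simp add: mult.commute)
qed

lemma sum_weight_tableaux_to_Suc:
  "(\<Sum>T\<in>tableaux_to h w (Suc k) \<mu>. weight (Suc k) x T)
    = (\<Sum>(\<kappa>, \<nu>)\<in>peaks h w \<mu>. x (Suc k) ^ nat (- int (psize \<nu>) + 2 * int (psize \<kappa>) - int (psize \<mu>))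
        * (\<Sum>T\<in>tableaux_to h w k \<nu>. weight k x T))"
proof -
  let ?S = "SIGMA z:peaks h w \<mu>. tableaux_to h w k (snd z)"
  let ?f = "\<lambda>((\<kappa>, \<nu>::nat \<Rightarrow> nat), T). T @ [\<kappa>, \<mu>]"
  let ?e = "\<lambda>\<kappa> \<nu>. nat (- int (psize \<nu>) + 2 * int (psize \<kappa>) - int (psize \<mu>))"
  have inj: "inj_on ?f ?S"
    by (rule inj_onI) (auto simp: tableaux_to_def)
  have "(\<Sum>T\<in>tableaux_to h w (Suc k) \<mu>. weight (Suc k) x T) = (\<Sum>z\<in>?S. weight (Suc k) x (?f z))"
    unfolding tableaux_to_Suc sum.reindex[OF inj] by (simp add: comp_def)
  also have "\<dots> = (\<Sum>(z, T)\<in>?S. x (Suc k) ^ ?e (fst z) (snd z) * weight k x T)"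
    by (rule sum.cong) (auto simp: tableaux_to_def weight_Suc)
  also have "\<dots> = (\<Sum>z\<in>peaks h w \<mu>. \<Sum>T\<in>tableaux_to h w k (snd z). x (Suc k) ^ ?e (fst z) (snd z) * weight k x T)"
    by (rule sum.Sigma[symmetric]) (auto intro: finite_peaks finite_tableaux_to)
  finally show ?thesis by (simp add: sum_distrib_left case_prod_unfold)
qed

text \<open>Both sides obey the same recurrence in \<open>k\<close>. For \<open>k = 0\<close> the rows are the unit vectors at the
  positions of \<open>\<mu>\<close>, cut off after the first \<open>h\<close> entries; unless \<open>\<mu>\<close> is empty, its largest position exceeds \<open>h\<close> and gives a zero row.\<close>

lemma det_reflected_eq_sum_tableaux_to:
  fixes x :: "nat \<Rightarrow> 'a::comm_ring_1"
  assumes h: "h > 0" and "\<mu> \<in> partitions h" "\<mu> 0 \<le> w" and N: "N = 2 * (int h + int w + 1)"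
  shows "det (mat h h (\<lambda>(a, b). reflected N k x (pos h \<mu> a) (int b + 1)))
    = (\<Sum>T\<in>tableaux_to h w k \<mu>. weight k x T)"
  using assms(2,3)
proof (induction k arbitrary: \<mu>)
  case 0
  have delta: "reflected N 0 x (pos h \<mu> a) (int b + 1) = (if pos h \<mu> a = int b + 1 then 1 else 0)"
    if "a < h" "b < h" for a b
  proof (rule reflected_0[OF N])
    have "\<mu> (h - Suc a) \<le> \<mu> 0" using 0 by (auto simp: partitions_def antimono_def)
    then show "pos h \<mu> a < int h + int w + 1" using 0 that by (simp add: pos_def)
  qed (use that in \<open>auto simp: pos_def\<close>)
  show ?case
  proof (cases "\<mu> = (\<lambda>_. 0)")
    case True
    have "reflected N 0 x (pos h \<mu> a) (int b + 1) = (if a = b then 1 else 0)" if "a < h" "b < h" for a b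
      unfolding delta[OF that] by (simp add: True pos_def)
    then have "mat h h (\<lambda>(a, b). reflected N 0 x (pos h \<mu> a) (int b + 1)) = 1\<^sub>m h"
      by (intro eq_matI) auto
    then show ?thesis by (simp add: tableaux_to_0 True weight_def)
  next
    case False
    then obtain i where "\<mu> i \<noteq> 0" by auto
    then have "\<mu> 0 \<noteq> 0" using 0 
      using antimonoD[of \<mu> 0 i] by (auto simp: partitions_def)
    then have "pos h \<mu> (h - 1) > int h" using h by (simp add: pos_def)
    then have "det (mat h h (\<lambda>(a, b). reflected N 0 x (pos h \<mu> a) (int b + 1))) = 0"
      using h by (intro det_eq_0_if_row_0[of "h - 1"]) (auto simp: delta)
    then show ?thesis using False by (simp add: tableaux_to_0)
  qed
next
  case (Suc k)
  have "N \<noteq> 0" using N by simp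
  have "det (mat h h (\<lambda>(a, b). reflected N (Suc k) x (pos h \<mu> a) (int b + 1)))
      = (\<Sum>(\<kappa>, \<nu>)\<in>peaks h w \<mu>. x (Suc k) ^ nat (- int (psize \<nu>) + 2 * int (psize \<kappa>) - int (psize \<mu>))
        * det (mat h h (\<lambda>(a, b). reflected N k x (pos h \<nu> a) (int b + 1))))"
    unfolding reflected_Suc[OF \<open>N \<noteq> 0\<close>] using Suc.prems
    by (intro det_pos_step h reflected_wall_0 reflected_wall_half_period[OF N])
  also have "\<dots> = (\<Sum>(\<kappa>, \<nu>)\<in>peaks h w \<mu>.
      x (Suc k) ^ nat (- int (psize \<nu>) + 2 * int (psize \<kappa>) - int (psize \<mu>))
        * (\<Sum>T\<in>tableaux_to h w k \<nu>. weight k x T))"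
    by (rule sum.cong) (auto simp: peaks_def vstrip_moves_def Suc.IH)
  finally show ?case by (simp only: sum_weight_tableaux_to_Suc)
qed

section \<open>Up-down tableaux\<close>

lemma is_partition_of_partitions: "\<mu> \<in> partitions h \<Longrightarrow> is_partition \<mu>"
  using finite_subset[of "{i. \<mu> i \<noteq> 0}" "{..<h}"] partitions_support[of \<mu> h]
  by (auto simp: is_partition_def partitions_def)

lemma partitions_iff: "\<mu> \<in> partitions h \<longleftrightarrow> is_partition \<mu> \<and> num_rows \<mu> \<le> h"
proof
  assume \<mu>: "\<mu> \<in> partitions h"
  have "fst ` diagram \<mu> \<subseteq> {..<h}"
    using partitions_support[OF \<mu>] by (auto simp: diagram_def)
  then have "num_rows \<mu> \<le> card {..<h}" unfolding num_rows_def by (intro card_mono) auto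
  then show "is_partition \<mu> \<and> num_rows \<mu> \<le> h" using is_partition_of_partitions[OF \<mu>] by simp
next
  assume "is_partition \<mu> \<and> num_rows \<mu> \<le> h"
  then show "\<mu> \<in> partitions h" using rows_le_D by (auto simp: partitions_def is_partition_def)
qed

lemma num_columns_eq:
  assumes "is_partition \<mu>"
  shows "num_columns \<mu> = \<mu> 0"
proof -
  have "\<mu> i \<le> \<mu> 0" for i using assms by (auto simp: is_partition_def antimono_def)
  then have "snd ` diagram \<mu> = {..<\<mu> 0}" by (force simp: diagram_def intro: less_le_trans)
  then show ?thesis by (simp add: num_columns_def)
qed

lemma differ_by_vertical_strip_commute:
  "differ_by_vertical_strip \<mu> \<nu> \<longleftrightarrow> differ_by_vertical_strip \<nu> \<mu>"
  by (simp add: differ_by_vertical_strip_def Un_commute)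

text \<open>For nested diagrams the cells of row \<open>i\<close> of the difference have the consecutive columns from \<open>\<mu> i\<close>
  to \<open>\<kappa> i - 1\<close>, so there is at most one of them iff \<open>\<kappa> i\<close> exceeds \<open>\<mu> i\<close> by at most one.\<close>

lemma vstrip_below_iff:
  "diagram \<mu> \<subseteq> diagram \<kappa> \<and> differ_by_vertical_strip \<mu> \<kappa> \<longleftrightarrow> (\<forall>i. \<kappa> i = \<mu> i \<or> \<kappa> i = \<mu> i + 1)"
  (is "?L \<longleftrightarrow> ?R")
proof
  assume ?L
  show ?R
  proof
    fix i
    have "\<mu> i \<le> \<kappa> i" "\<kappa> i \<le> \<mu> i + 1"
      using \<open>?L\<close> vertical_strip_le by (auto simp: diagram_subset_iff)
    then show "\<kappa> i = \<mu> i \<or> \<kappa> i = \<mu> i + 1" by linarith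
  qed
next
  assume R: ?R
  have sub: "diagram \<mu> \<subseteq> diagram \<kappa>"
    unfolding diagram_subset_iff
  proof
    fix i show "\<mu> i \<le> \<kappa> i" using R[rule_format, of i] by auto
  qed
  have "j = \<mu> i" if "(i, j) \<in> diagram \<kappa> - diagram \<mu>" for i j
    using that R[rule_format, of i] by (auto simp: diagram_def)
  then have "vertical_strip (diagram \<kappa> - diagram \<mu>)" unfolding vertical_strip_def by blast
  moreover have "diagram \<mu> - diagram \<kappa> = {}" using sub by blast
  ultimately show ?L using sub by (simp only: differ_by_vertical_strip_def Un_empty_left simp_thms)
qed

lemma in_peaks_iff:
  assumes "\<mu> \<in> partitions h"
  shows "(\<kappa>, \<nu>) \<in> peaks h w \<mu> \<longleftrightarrow> \<kappa> \<in> partitions h \<and> \<nu> \<in> partitions h \<and> num_columns \<nu> \<le> w \<and>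
    diagram \<mu> \<subseteq> diagram \<kappa> \<and> diagram \<nu> \<subseteq> diagram \<kappa> \<and>
    differ_by_vertical_strip \<nu> \<kappa> \<and> differ_by_vertical_strip \<kappa> \<mu>"
proof -
  have "(\<forall>i. int (\<kappa> i) = int (\<mu> i) \<or> int (\<kappa> i) = int (\<mu> i) + 1)
      \<longleftrightarrow> diagram \<mu> \<subseteq> diagram \<kappa> \<and> differ_by_vertical_strip \<kappa> \<mu>"
    unfolding differ_by_vertical_strip_commute[of \<kappa>] vstrip_below_iff
    by (intro arg_cong[where f = All] ext) linarith
  moreover have "(\<forall>i. int (\<nu> i) = int (\<kappa> i) \<or> int (\<nu> i) = int (\<kappa> i) + - 1)
      \<longleftrightarrow> diagram \<nu> \<subseteq> diagram \<kappa> \<and> differ_by_vertical_strip \<nu> \<kappa>"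
    unfolding vstrip_below_iff by (intro arg_cong[where f = All] ext) linarith
  ultimately show ?thesis
    by (auto simp: peaks_def vstrip_moves_def num_columns_eq[OF is_partition_of_partitions])
qed

lemma diagram_empty_iff: "diagram \<mu> = {} \<longleftrightarrow> \<mu> = (\<lambda>_. 0)"
  by (auto simp: diagram_def fun_eq_iff)

lemma zero_in_partitions: "(\<lambda>_. 0) \<in> partitions h"
  by (simp add: partitions_def antimono_def)

lemma UD_eq_tableaux_to: "UD n h w = tableaux_to h w n (\<lambda>_. 0)"
proof (intro equalityI subsetI)
  fix T assume T: "T \<in> UD n h w"
  have len: "length T = 2 * n + 1" and ends: "T ! 0 = (\<lambda>_. 0)" "T ! (2 * n) = (\<lambda>_. 0)"
    using T by (auto simp: UD_def diagram_empty_iff)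
  have part: "T ! k \<in> partitions h" if "k \<le> 2 * n" for k
  proof (cases "k = 0")
    case True
    then show ?thesis by (simp add: ends zero_in_partitions)
  next
    case False
    have "T ! k \<in> set T" using that len by simp
    then show ?thesis using T that False by (simp add: UD_def partitions_iff)
  qed
  have cols: "num_columns (T ! (2 * i)) \<le> w" if "i \<le> n" for i
  proof (cases "i = 0")
    case True
    then show ?thesis using diagram_empty_iff[of "T ! 0"] ends by (simp add: num_columns_def)
  qed (use T that in \<open>simp add: UD_def\<close>)
  have "(T ! (2 * i + 1), T ! (2 * i)) \<in> peaks h w (T ! (2 * i + 2))" if "i < n" for i
  proof -
    have "\<forall>i\<in>{1..n}. diagram (T ! (2 * i - 2)) \<subseteq> diagram (T ! (2 * i - 1)) \<and>
                 diagram (T ! (2 * i)) \<subseteq> diagram (T ! (2 * i - 1))"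
      and s: "\<forall>i\<in>{1..2 * n}. differ_by_vertical_strip (T ! (i - 1)) (T ! i)"
      using T by (auto simp: UD_def)
    from this(1)[rule_format, of "i + 1"] s[rule_format, of "2 * i + 1"] s[rule_format, of "2 * i + 2"]
    show ?thesis using that part cols by (simp add: in_peaks_iff)
  qed
  then show "T \<in> tableaux_to h w n (\<lambda>_. 0)" using len ends by (simp add: tableaux_to_def)
next
  fix T assume "T \<in> tableaux_to h w n (\<lambda>_. 0)"
  then have len: "length T = 2 * n + 1" and ends: "T ! 0 = (\<lambda>_. 0)" "T ! (2 * n) = (\<lambda>_. 0)"
    and pk: "\<And>i. i < n \<Longrightarrow> (T ! (2 * i + 1), T ! (2 * i)) \<in> peaks h w (T ! (2 * i + 2))"
    by (auto simp: tableaux_to_def)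
  have part_odd: "T ! (2 * i + 1) \<in> partitions h" if "i < n" for i
    using pk[OF that] by (simp add: peaks_def vstrip_moves_def)
  have evens: "T ! (2 * i) \<in> partitions h \<and> (T ! (2 * i)) 0 \<le> w" if "i \<le> n" for i
  proof (cases "i = n")
    case True
    then show ?thesis by (simp add: ends zero_in_partitions)
  next
    case False
    then show ?thesis using pk[of i] that by (simp add: peaks_def vstrip_moves_def)
  qed
  have part: "T ! k \<in> partitions h" if "k \<le> 2 * n" for k
  proof (cases "even k")
    case True
    then show ?thesis using evens[of "k div 2"] that by auto
  next
    case False
    then show ?thesis using part_odd[of "k div 2"] that by (auto elim!: oddE)
  qed
  have peak: "num_columns (T ! (2 * i)) \<le> w \<and>
      diagram (T ! (2 * i + 2)) \<subseteq> diagram (T ! (2 * i + 1)) \<and>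
      diagram (T ! (2 * i)) \<subseteq> diagram (T ! (2 * i + 1)) \<and>
      differ_by_vertical_strip (T ! (2 * i)) (T ! (2 * i + 1)) \<and>
      differ_by_vertical_strip (T ! (2 * i + 1)) (T ! (2 * i + 2))" if "i < n" for i
    using pk[OF that] in_peaks_iff[OF part[of "2 * i + 2"]] that by simp
  have "diagram (T ! (2 * i - 2)) \<subseteq> diagram (T ! (2 * i - 1)) \<and>
      diagram (T ! (2 * i)) \<subseteq> diagram (T ! (2 * i - 1))" if "i \<in> {1..n}" for i
    using peak[of "i - 1"] that by (cases i) auto
  moreover have "differ_by_vertical_strip (T ! (i - 1)) (T ! i)" if "i \<in> {1..2 * n}" for i
  proof (cases "even i")
    case True
    then obtain j where "i = 2 * j" by blast
    then show ?thesis using peak[of "j - 1"] that by (cases j) auto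
  next
    case False
    then obtain j where "i = 2 * j + 1" by (rule oddE)
    then show ?thesis using peak[of j] that by auto
  qed
  moreover have "is_partition \<mu>" if "\<mu> \<in> set T" for \<mu>
    using that len part by (auto simp: in_set_conv_nth less_Suc_eq_le intro!: is_partition_of_partitions[of _ h])
  moreover have "num_rows (T ! i) \<le> h" if "i \<in> {1..2 * n}" for i
    using part[of i] that by (simp add: partitions_iff)
  moreover have "num_columns (T ! (2 * i)) \<le> w" if "i \<in> {1..n}" for i
    using evens[of i] that num_columns_eq[OF is_partition_of_partitions] by auto
  ultimately show "T \<in> UD n h w"
    using len ends diagram_empty_iff[of "T ! 0"] diagram_empty_iff[of "T ! (2 * n)"]
    by (auto simp: UD_def)
qed

theorem theorem7p2:
  fixes h w n :: nat and x :: "nat \<Rightarrow> 'a::comm_ring_1"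
  assumes "h > 0" and "w > 0" and "n > 0"
  shows "det (mat h h (\<lambda>(a, b). let i = int a + 1; j = int b + 1; N = 2 * int h + 2 * int w + 2
                                in Fsum n x (- i + j) N - Fsum n x (i + j) N))
         = (\<Sum>T\<in>UD n h w. weight n x T)"
proof -
  define N where "N = 2 * int h + 2 * int w + 2"
  have "det (mat h h (\<lambda>(a, b). let i = int a + 1; j = int b + 1; N = 2 * int h + 2 * int w + 2
                                in Fsum n x (- i + j) N - Fsum n x (i + j) N))
      = det (mat h h (\<lambda>(a, b). reflected N n x (pos h (\<lambda>_. 0) a) (int b + 1)))"
    by (simp add: reflected_def pos_def Let_def N_def)
  also have "\<dots> = (\<Sum>T\<in>tableaux_to h w n (\<lambda>_. 0). weight n x T)"
    using assms by (intro det_reflected_eq_sum_tableaux_to zero_in_partitions) (simp_all add: N_def)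
  finally show ?thesis by (simp only: UD_eq_tableaux_to)
qed

end
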